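(* Let $\mathcal{E}$ be an error basis on $\mathbb{C}^q$. Let $M_1,M_2$ be Hermitian operators on $\mathfrak{H}=(\mathbb{C}^q)^{\otimes n}$ and $N_1,N_2$ Hermitian operators on $\mathfrak{K}=(\mathbb{C}^q)^{\otimes n'}$, and let $J\subseteq\{1,\dots,n\}$ and $K\subseteq\{1,\dots,n'\}$ be subsets of legs of these spaces. Then $$\mathbf{A}^{(J\cup K)}(z;M_1\otimes N_1,M_2\otimes N_2)=\mathbf{A}^{(J)}(z;M_1,M_2)\otimes\mathbf{A}^{(K)}(z;N_1,N_2),$$ and $$\mathbf{B}^{(J\cup K)}(z;M_1\otimes N_1,M_2\otimes N_2)=\mathbf{B}^{(J)}(z;M_1,M_2)\otimes\mathbf{B}^{(K)}(z;N_1,N_2).$$ Here $J\cup K$ denotes the set of legs $J\cup(n+K)$ of $\mathfrak{H}\otimes\mathfrak{K}=(\mathbb{C}^q)^{\otimes(n+n')}$.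
   Context: An error basis on $\mathbb{C}^q$ is a set $\mathcal{E}$ of unitary operators containing $I$ that is a basis of $L(\mathbb{C}^q)$ (so $|\mathcal{E}|=q^2$), with $\operatorname{Tr}(EF^\dagger)=0$ for $E\neq F$, and such that $EF=\omega(E,F)FE$ for all $E,F\in\mathcal{E}$, with scalars $\omega(E,F)\in\mathbb{C}$ satisfying $\omega(E,F)^r=1$ for some fixed $r$. Put $\mathcal{E}^n=\{E_1\otimes\cdots\otimes E_n: E_i\in\mathcal{E}\}$; the weight $\mathrm{wt}(E_1\otimes\cdots\otimes E_n)$ is the number of $i$ with $E_i\ne I$. For $J=\{j_1<\dots<j_m\}\subseteq\{1,\dots,n\}$, $E\in\mathcal{E}^m$, $F\in\mathcal{E}^{n-m}$, the operator $E\otimes_J F\in\mathcal{E}^n$ has $E_k$ as its $j_k$-th tensor factor ($k=1,\dots,m$) and the factors of $F$, in order, in the remaining positions. Let $V$ be the vector space over $\mathbb{C}$ with formal basis $\{e_{E,E'}:E,E'\in\mathcal{E}\}$; for $E,E'\in\mathcal{E}^m$ write $e_{E,E'}=e_{E_1,E_1'}\otimes\cdots\otimes e_{E_m,E_m'}\in V^{\otimes m}$. The tensor enumerators, elements of $\mathbb{C}[z]\otimes V^{\otimes m}$, are $$\mathbf{A}^{(J)}(z;M_1,M_2)=\sum_{E,E'\in\mathcal{E}^m}\sum_{F\in\mathcal{E}^{n-m}}\operatorname{Tr}((E\otimes_JF)^\dagger M_1)\operatorname{Tr}((E'\otimes_JF)M_2)\,z^{\mathrm{wt}(F)}e_{E,E'},$$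 $$\mathbf{B}^{(J)}(z;M_1,M_2)=\sum_{E,E'\in\mathcal{E}^m}\sum_{F\in\mathcal{E}^{n-m}}\operatorname{Tr}((E\otimes_JF)^\dagger M_1(E'\otimes_JF)M_2)\,z^{\mathrm{wt}(F)}e_{E,E'}.$$ The tensor product of enumerators is the $\mathbb{C}[z]$-bilinear one (polynomial coefficients are multiplied). *)

theory Defs
  imports
    "Jordan_Normal_Form.Schur_Decomposition"
    "Jordan_Normal_Form.VS_Connect"
    "HOL-Library.Poly_Mapping"
begin

definition trace :: "complex mat \<Rightarrow> complex" where
  "trace A = (\<Sum>i<dim_row A. A $$ (i, i))"

definition unitary_op :: "nat \<Rightarrow> complex mat \<Rightarrow> bool" where
  "unitary_op d U \<longleftrightarrow>
     U \<in> carrier_mat d d \<and> U * mat_adjoint U = 1\<^sub>m d \<and> mat_adjoint U * U = 1\<^sub>m d"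

definition hermitian_op :: "nat \<Rightarrow> complex mat \<Rightarrow> bool" where
  "hermitian_op d M \<longleftrightarrow> M \<in> carrier_mat d d \<and> mat_adjoint M = M"

definition error_basis :: "nat \<Rightarrow> complex mat set \<Rightarrow> bool" where
  "error_basis q \<E> \<longleftrightarrow>
     (\<forall>E\<in>\<E>. unitary_op q E) \<and>
     1\<^sub>m q \<in> \<E> \<and>
     vectorspace.basis class_ring (module_mat TYPE(complex) q q) \<E> \<and>
     (\<forall>E\<in>\<E>. \<forall>F\<in>\<E>. E \<noteq> F \<longrightarrow> trace (E * mat_adjoint F) = 0) \<and>
     (\<exists>r>0. \<exists>\<omega> :: complex mat \<Rightarrow> complex mat \<Rightarrow> complex.
        \<forall>E\<in>\<E>. \<forall>F\<in>\<E>. \<omega> E F ^ r = 1 \<and> E * F = \<omega> E F \<cdot>\<^sub>m (F * E))"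

text \<open>
  The space $(\mathbb{C}^q)^{\otimes n}$ is identified with $\mathbb{C}^{q^n}$ by reading a
  multi-index $(i_1,\ldots,i_n)$ with $0 \le i_k < q$ as a base-$q$ numeral, most significant
  digit first. Under this identification the tensor product of operators is the Kronecker
  product of matrices, and $(\mathbb{C}^q)^{\otimes n} \otimes (\mathbb{C}^q)^{\otimes n'}$ is
  $(\mathbb{C}^q)^{\otimes (n+n')}$.
\<close>

definition tensor_op :: "complex mat \<Rightarrow> complex mat \<Rightarrow> complex mat" (infixl "\<otimes>\<^sub>O" 70) where
  "A \<otimes>\<^sub>O B = mat (dim_row A * dim_row B) (dim_col A * dim_col B)
     (\<lambda>(i, j). A $$ (i div dim_row B, j div dim_col B) * B $$ (i mod dim_row B, j mod dim_col B))"

definition tensor_list :: "complex mat list \<Rightarrow> complex mat" where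
  "tensor_list Es = foldr (\<otimes>\<^sub>O) Es (1\<^sub>m 1)"

definition error_ops :: "complex mat set \<Rightarrow> nat \<Rightarrow> complex mat set" where
  "error_ops \<E> n = {tensor_list Es | Es. length Es = n \<and> set Es \<subseteq> \<E>}"

text \<open>
  The tuple $(E_1,\ldots,E_n)$ with $E = E_1 \otimes \cdots \otimes E_n$, each $E_i$ in the error
  basis. It is unique; see \<open>factors_tensor_list\<close> below.
\<close>

definition factors :: "complex mat set \<Rightarrow> nat \<Rightarrow> complex mat \<Rightarrow> complex mat list" where
  "factors \<E> n E = (THE Es. length Es = n \<and> set Es \<subseteq> \<E> \<and> tensor_list Es = E)"

definition wt :: "nat \<Rightarrow> complex mat set \<Rightarrow> nat \<Rightarrow> complex mat \<Rightarrow> nat" where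
  "wt q \<E> n E = card {i. i < n \<and> factors \<E> n E ! i \<noteq> 1\<^sub>m q}"

text \<open>
  Legs are numbered from 1. If \<open>i\<close> lies in \<open>J\<close> then it is the element of \<open>J\<close> with (0-based)
  rank \<open>card {j \<in> J. j < i}\<close>, and otherwise the leg with rank
  \<open>card {j \<in> {1..n} - J. j < i}\<close> among the remaining ones.
\<close>

definition interleave :: "nat \<Rightarrow> nat set \<Rightarrow> 'a list \<Rightarrow> 'a list \<Rightarrow> 'a list" where
  "interleave n J xs ys =
     map (\<lambda>i. if i \<in> J then xs ! card {j \<in> J. j < i} else ys ! card {j \<in> {1..n} - J. j < i})
       [1..<Suc n]"

definition tensor_at ::
  "complex mat set \<Rightarrow> nat \<Rightarrow> nat set \<Rightarrow> complex mat \<Rightarrow> complex mat \<Rightarrow> complex mat" where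
  "tensor_at \<E> n J E F =
     tensor_list (interleave n J (factors \<E> (card J) E) (factors \<E> (n - card J) F))"

text \<open>
  Let $V$ have the formal basis $e_{E,E'}$. A list $[(E_1,E_1'),\ldots,(E_m,E_m')]$ stands for
  the basis vector $e_{E_1,E_1'} \otimes \cdots \otimes e_{E_m,E_m'}$ of $V^{\otimes m}$, and an
  element of $\mathbb{C}[z] \otimes V^{\otimes m}$ is given by its polynomial coefficients,
  finitely many nonzero, in this basis. One type serves for all \<open>m\<close> (that is, for the tensor
  algebra of $V$ over $\mathbb{C}[z]$), so that $V^{\otimes m} \otimes V^{\otimes m'}$ and
  $V^{\otimes (m+m')}$ are identified, with concatenation as tensor product of basis vectors.
\<close>

type_synonym tensor = "(complex mat \<times> complex mat) list \<Rightarrow>\<^sub>0 complex poly"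

definition tensor_prod :: "tensor \<Rightarrow> tensor \<Rightarrow> tensor" (infixl "\<otimes>\<^sub>V" 70) where
  "x \<otimes>\<^sub>V y = (\<Sum>k\<in>Poly_Mapping.keys x. \<Sum>l\<in>Poly_Mapping.keys y.
      Poly_Mapping.single (k @ l) (Poly_Mapping.lookup x k * Poly_Mapping.lookup y l))"

text \<open>\<open>term_e \<E> m p E E'\<close> is $p \cdot e_{E,E'}$ for a polynomial $p$ and $E, E' \in \mathcal{E}^m$.\<close>

definition term_e ::
  "complex mat set \<Rightarrow> nat \<Rightarrow> complex poly \<Rightarrow> complex mat \<Rightarrow> complex mat \<Rightarrow> tensor" where
  "term_e \<E> m p E E' = Poly_Mapping.single (zip (factors \<E> m E) (factors \<E> m E')) p"

definition enum_A ::
  "nat \<Rightarrow> complex mat set \<Rightarrow> nat \<Rightarrow> nat set \<Rightarrow> complex mat \<Rightarrow> complex mat \<Rightarrow> tensor" where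
  "enum_A q \<E> n J M1 M2 =
     (\<Sum>E\<in>error_ops \<E> (card J). \<Sum>E'\<in>error_ops \<E> (card J). \<Sum>F\<in>error_ops \<E> (n - card J).
        term_e \<E> (card J)
          (Polynomial.monom
            (trace (mat_adjoint (tensor_at \<E> n J E F) * M1) * trace (tensor_at \<E> n J E' F * M2))
            (wt q \<E> (n - card J) F))
          E E')"

definition enum_B ::
  "nat \<Rightarrow> complex mat set \<Rightarrow> nat \<Rightarrow> nat set \<Rightarrow> complex mat \<Rightarrow> complex mat \<Rightarrow> tensor" where
  "enum_B q \<E> n J M1 M2 =
     (\<Sum>E\<in>error_ops \<E> (card J). \<Sum>E'\<in>error_ops \<E> (card J). \<Sum>F\<in>error_ops \<E> (n - card J).
        term_e \<E> (card J)
          (Polynomial.monom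
            (trace (mat_adjoint (tensor_at \<E> n J E F) * M1 * tensor_at \<E> n J E' F * M2))
            (wt q \<E> (n - card J) F))
          E E')"

lemma trace_mult_smult_left:
  fixes A B :: "complex mat"
  assumes "A \<in> carrier_mat d d" "B \<in> carrier_mat d d"
  shows "trace ((c \<cdot>\<^sub>m A) * B) = c * trace (A * B)"
  using assms by (auto simp: trace_def scalar_prod_def sum_distrib_left mult_ac)

lemma trace_one: "trace (1\<^sub>m d) = of_nat d"
  by (simp add: trace_def)

lemma error_basis_dim_pos:
  assumes "error_basis q \<E>"
  shows "q > 0"
proof (rule ccontr)
  assume "\<not> q > 0"
  then have q: "q = 0" by simp
  interpret vectorspace class_ring "module_mat TYPE(complex) q q" by (rule matrix_vs)
  have "1\<^sub>m q \<in> \<E>" "basis \<E>" using assms by (auto simp: error_basis_def)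
  then have "\<not> lin_dep \<E>" by (auto simp: basis_def)
  moreover have "1\<^sub>m q = \<zero>\<^bsub>module_mat TYPE(complex) q q\<^esub>"
    using q by (intro eq_matI) (auto simp: module_mat_simps)
  ultimately show False
    using \<open>1\<^sub>m q \<in> \<E>\<close> \<open>basis \<E>\<close> vs_zero_lin_dep[of \<E>] by (auto simp: basis_def)
qed

lemma error_basis_scalar_eq:
  assumes eb: "error_basis q \<E>" and A: "A \<in> \<E>" "A' \<in> \<E>" and eq: "b \<cdot>\<^sub>m A = b' \<cdot>\<^sub>m A'"
    and b: "b \<noteq> 0"
  shows "A = A'"
proof (rule ccontr)
  assume ne: "A \<noteq> A'"
  have U: "unitary_op q A" "unitary_op q A'" using eb A by (auto simp: error_basis_def)
  then have c: "A \<in> carrier_mat q q" "A' \<in> carrier_mat q q" by (auto simp: unitary_op_def)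
  have adj: "mat_adjoint A \<in> carrier_mat q q" using c by (auto simp: mat_adjoint_def)
  have "b * trace (A * mat_adjoint A) = b' * trace (A' * mat_adjoint A)"
    using trace_mult_smult_left[OF c(1) adj, of b] trace_mult_smult_left[OF c(2) adj, of b'] eq
    by simp
  moreover have "trace (A' * mat_adjoint A) = 0" using eb A ne by (auto simp: error_basis_def)
  moreover have "trace (A * mat_adjoint A) = of_nat q" using U by (simp add: unitary_op_def trace_one)
  ultimately show False using b error_basis_dim_pos[OF eb] by simp
qed

lemma error_basis_nonzero:
  assumes "error_basis q \<E>" "A \<in> \<E>"
  shows "\<exists>i<q. \<exists>j<q. A $$ (i, j) \<noteq> 0"
proof (rule ccontr)
  assume z: "\<not> ?thesis"
  have c: "A \<in> carrier_mat q q" and u: "A * mat_adjoint A = 1\<^sub>m q"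
    using assms by (auto simp: error_basis_def unitary_op_def)
  have "A = 0\<^sub>m q q" using z c by (intro eq_matI) auto
  then have "A * mat_adjoint A = 0\<^sub>m q q" by (simp add: mat_adjoint_def)
  then have "1\<^sub>m q $$ (0, 0) = (0\<^sub>m q q $$ (0, 0) :: complex)" using u by simp
  then show False using error_basis_dim_pos[OF assms(1)] by simp
qed

lemma tensor_op_index:
  assumes "A \<in> carrier_mat a a" "B \<in> carrier_mat b b" "i < a" "j < a" "k < b" "l < b"
  shows "(A \<otimes>\<^sub>O B) $$ (i * b + k, j * b + l) = A $$ (i, j) * B $$ (k, l)"
proof -
  have lt: "x * b + y < a * b" if "x < a" "y < b" for x y
  proof -
    have "x * b + y < Suc x * b" using that by simp
    also have "\<dots> \<le> a * b" using that by (intro mult_le_mono1) simp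
    finally show ?thesis .
  qed
  show ?thesis using assms lt by (simp add: tensor_op_def)
qed

lemma tensor_list_simps:
  "tensor_list [] = 1\<^sub>m 1" "tensor_list (E # Es) = E \<otimes>\<^sub>O tensor_list Es"
  by (simp_all add: tensor_list_def)

lemma tensor_list_carrier:
  assumes "\<And>E. E \<in> set Es \<Longrightarrow> E \<in> carrier_mat q q"
  shows "tensor_list Es \<in> carrier_mat (q ^ length Es) (q ^ length Es)"
  using assms
proof (induction Es)
  case (Cons E Es)
  then have "E \<in> carrier_mat q q" "tensor_list Es \<in> carrier_mat (q ^ length Es) (q ^ length Es)"
    by auto
  then show ?case by (auto simp: tensor_list_simps tensor_op_def)
qed (auto simp: tensor_list_simps)

lemma tensor_list_nonzero:
  assumes eb: "error_basis q \<E>" and "set Es \<subseteq> \<E>"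
  shows "\<exists>k<q ^ length Es. \<exists>l<q ^ length Es. tensor_list Es $$ (k, l) \<noteq> 0"
  using assms(2)
proof (induction Es)
  case (Cons E Es)
  have car: "X \<in> carrier_mat q q" if "X \<in> \<E>" for X
    using that eb by (auto simp: error_basis_def unitary_op_def)
  from Cons obtain k l where kl: "k < q ^ length Es" "l < q ^ length Es" "tensor_list Es $$ (k, l) \<noteq> 0"
    by auto
  from Cons.prems error_basis_nonzero[OF eb, of E] obtain i j where
    ij: "i < q" "j < q" "E $$ (i, j) \<noteq> 0" by auto
  let ?b = "q ^ length Es"
  have T: "tensor_list Es \<in> carrier_mat ?b ?b" using Cons.prems car by (intro tensor_list_carrier) auto
  have E: "E \<in> carrier_mat q q" using Cons.prems car by auto
  have nz: "tensor_list (E # Es) $$ (i * ?b + k, j * ?b + l) \<noteq> 0"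
    using tensor_op_index[OF E T ij(1,2) kl(1,2)] ij kl by (simp add: tensor_list_simps)
  have lt: "x * ?b + y < q ^ length (E # Es)" if "x < q" "y < ?b" for x y
  proof -
    have "x * ?b + y < Suc x * ?b" using that by simp
    also have "\<dots> \<le> q * ?b" using that by (intro mult_le_mono1) simp
    finally show ?thesis by simp
  qed
  show ?case using nz lt ij kl by blast
qed (auto simp: tensor_list_simps)

lemma tensor_list_inj:
  assumes eb: "error_basis q \<E>" and "set Es \<subseteq> \<E>" "set Fs \<subseteq> \<E>" "length Es = length Fs"
    and "tensor_list Es = tensor_list Fs"
  shows "Es = Fs"
  using assms(4,2,3,5)
proof (induction Es Fs rule: list_induct2)
  case (Cons E Es F Fs)
  let ?b = "q ^ length Es"
  have car: "X \<in> carrier_mat q q" if "X \<in> \<E>" for X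
    using that eb by (auto simp: error_basis_def unitary_op_def)
  have E: "E \<in> carrier_mat q q" "F \<in> carrier_mat q q" using Cons.prems car by auto
  have T: "tensor_list Es \<in> carrier_mat ?b ?b" using Cons.prems car by (intro tensor_list_carrier) auto
  have T': "tensor_list Fs \<in> carrier_mat ?b ?b"
    unfolding Cons.hyps using Cons.prems car by (intro tensor_list_carrier) auto
  have entries: "E $$ (i, j) * tensor_list Es $$ (k, l) = F $$ (i, j) * tensor_list Fs $$ (k, l)"
    if "i < q" "j < q" "k < ?b" "l < ?b" for i j k l
    using tensor_op_index[OF E(1) T that] tensor_op_index[OF E(2) T' that] Cons.prems(3)
    by (simp add: tensor_list_simps)
  from tensor_list_nonzero[OF eb, of Es] Cons.prems obtain k l where
    kl: "k < ?b" "l < ?b" "tensor_list Es $$ (k, l) \<noteq> 0" by auto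
  have "tensor_list Es $$ (k, l) \<cdot>\<^sub>m E = tensor_list Fs $$ (k, l) \<cdot>\<^sub>m F"
    using entries kl E by (intro eq_matI) (auto simp: mult.commute)
  then have EF: "E = F" using error_basis_scalar_eq[OF eb _ _ _ kl(3)] Cons.prems by auto
  from error_basis_nonzero[OF eb, of E] Cons.prems obtain i j where
    ij: "i < q" "j < q" "E $$ (i, j) \<noteq> 0" by auto
  have "tensor_list Es = tensor_list Fs"
    using entries[OF ij(1,2)] ij(3) T T' by (intro eq_matI) (auto simp: EF)
  then show ?case using Cons EF by auto
qed simp

lemma factors_tensor_list:
  assumes "error_basis q \<E>" "set Es \<subseteq> \<E>"
  shows "factors \<E> (length Es) (tensor_list Es) = Es"
  unfolding factors_def using assms tensor_list_inj[OF assms(1)] by (intro the_equality) auto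

end

(*
Both sides are sums over tuples of basis elements. Tuples of length m + m' are concatenations
of tuples of lengths m and m', interleaving along the union of J and n + K is compatible with
concatenation, so each operator in the sum for J and n + K is a Kronecker product of the
corresponding operators for J and K. Adjoint, product and trace are multiplicative for
Kronecker products, hence each coefficient of the left-hand side factors.
*)
theory Submission
  imports Defs
begin

subsection \<open>Kronecker products\<close>

lemma tensor_op_dims [simp]:
  "dim_row (A \<otimes>\<^sub>O B) = dim_row A * dim_row B" "dim_col (A \<otimes>\<^sub>O B) = dim_col A * dim_col B"
  by (simp_all add: tensor_op_def)

lemma tensor_op_index_div_mod:
  assumes "i < dim_row A * dim_row B" "j < dim_col A * dim_col B"
  shows "(A \<otimes>\<^sub>O B) $$ (i, j) =
    A $$ (i div dim_row B, j div dim_col B) * B $$ (i mod dim_row B, j mod dim_col B)"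
  using assms by (simp add: tensor_op_def)

text \<open>The bound on \<open>i\<close> itself excludes \<open>b = 0\<close>, so index
  computations with empty matrices need no separate case.\<close>

lemma mod_less_of_less_mult: "(i::nat) mod b < b" if "i < a * b"
  using that by (cases "b = 0") auto

lemma sum_lessThan_mult:
  fixes f :: "nat \<Rightarrow> 'a::comm_monoid_add"
  shows "(\<Sum>k<a * b. f k) = (\<Sum>i<a. \<Sum>j<b. f (i * b + j))"
proof -
  have "sum f {i * b..<i * b + b} = (\<Sum>j<b. f (i * b + j))" for i
    using sum.shift_bounds_nat_ivl[of f 0 "i * b" b]
    by (simp add: add.commute atLeast0LessThan)
  then show ?thesis by (simp add: sum.nat_group [symmetric])
qed

text \<open>Quotient and remainder of \<open>k\<close> modulo \<open>b\<close> range independently.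
  Contractions of a flattened index, in matrix products and in traces, reduce to this.\<close>

lemma sum_div_mod:
  fixes f g :: "nat \<Rightarrow> 'a::comm_semiring_0"
  shows "(\<Sum>k<a * b. f (k div b) * g (k mod b)) = (\<Sum>i<a. f i) * (\<Sum>j<b. g j)"
proof -
  have "(\<Sum>k<a * b. f (k div b) * g (k mod b)) = (\<Sum>i<a. \<Sum>j<b. f i * g j)"
    unfolding sum_lessThan_mult by (intro sum.cong) auto
  then show ?thesis by (simp add: sum_product)
qed

text \<open>The mixed-product property. The hypotheses make both Kronecker products split the
  contracted index into the same quotient and remainder, so \<open>sum_div_mod\<close> separates the
  sum.\<close>

lemma tensor_op_mult:
  assumes "dim_col A = dim_row C" "dim_col B = dim_row D"
  shows "(A \<otimes>\<^sub>O B) * (C \<otimes>\<^sub>O D) = (A * C) \<otimes>\<^sub>O (B * D)"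
proof (rule eq_matI)
  fix i j
  assume "i < dim_row ((A * C) \<otimes>\<^sub>O (B * D))" "j < dim_col ((A * C) \<otimes>\<^sub>O (B * D))"
  then have i: "i < dim_row A * dim_row B" and j: "j < dim_col C * dim_col D" by auto
  note b = mod_less_of_less_mult[OF i] mod_less_of_less_mult[OF j]
    less_mult_imp_div_less[OF i] less_mult_imp_div_less[OF j]
  have "((A \<otimes>\<^sub>O B) * (C \<otimes>\<^sub>O D)) $$ (i, j) =
    (\<Sum>k<dim_row C * dim_row D. (A \<otimes>\<^sub>O B) $$ (i, k) * (C \<otimes>\<^sub>O D) $$ (k, j))"
    using i j assms by (simp add: scalar_prod_def atLeast0LessThan)
  also have "\<dots> = (\<Sum>k<dim_row C * dim_row D.
      (A $$ (i div dim_row B, k div dim_row D) * C $$ (k div dim_row D, j div dim_col D)) *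
      (B $$ (i mod dim_row B, k mod dim_row D) * D $$ (k mod dim_row D, j mod dim_col D)))"
    using i j assms by (intro sum.cong) (auto simp: tensor_op_index_div_mod)
  also have "\<dots> = (\<Sum>k<dim_row C. A $$ (i div dim_row B, k) * C $$ (k, j div dim_col D)) *
      (\<Sum>k<dim_row D. B $$ (i mod dim_row B, k) * D $$ (k, j mod dim_col D))"
    by (rule sum_div_mod)
  also have "\<dots> = ((A * C) \<otimes>\<^sub>O (B * D)) $$ (i, j)"
    using i j b assms
    by (simp add: tensor_op_index_div_mod scalar_prod_def atLeast0LessThan)
  finally show "((A \<otimes>\<^sub>O B) * (C \<otimes>\<^sub>O D)) $$ (i, j) = ((A * C) \<otimes>\<^sub>O (B * D)) $$ (i, j)" .
qed auto

text \<open>Squareness makes the row and column index of a diagonal entry split alike, so only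
  diagonal entries of \<open>A\<close> and \<open>B\<close> occur.\<close>

lemma trace_tensor_op:
  assumes "square_mat A" "square_mat B"
  shows "trace (A \<otimes>\<^sub>O B) = trace A * trace B"
  using assms sum_div_mod[of "\<lambda>i. A $$ (i, i)" "dim_row B" "\<lambda>i. B $$ (i, i)" "dim_row A"]
  by (simp add: trace_def tensor_op_index_div_mod)

lemma mat_adjoint_dims [simp]:
  "dim_row (mat_adjoint A) = dim_col A" "dim_col (mat_adjoint A) = dim_row A"
  by (simp_all add: mat_adjoint_def)

lemma mat_adjoint_index:
  fixes A :: "complex mat"
  assumes "i < dim_col A" "j < dim_row A"
  shows "mat_adjoint A $$ (i, j) = cnj (A $$ (j, i))"
  using assms by (simp add: mat_adjoint_def mat_of_rows_def)

lemma mat_adjoint_tensor_op: "mat_adjoint (A \<otimes>\<^sub>O B) = mat_adjoint A \<otimes>\<^sub>O mat_adjoint B"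
proof (rule eq_matI)
  fix i j
  assume "i < dim_row (mat_adjoint A \<otimes>\<^sub>O mat_adjoint B)" "j < dim_col (mat_adjoint A \<otimes>\<^sub>O mat_adjoint B)"
  then have i: "i < dim_col A * dim_col B" and j: "j < dim_row A * dim_row B" by auto
  note b = mod_less_of_less_mult[OF i] mod_less_of_less_mult[OF j]
    less_mult_imp_div_less[OF i] less_mult_imp_div_less[OF j]
  show "mat_adjoint (A \<otimes>\<^sub>O B) $$ (i, j) = (mat_adjoint A \<otimes>\<^sub>O mat_adjoint B) $$ (i, j)"
    using i j b by (simp add: mat_adjoint_index tensor_op_index_div_mod)
qed auto

lemma tensor_op_one_left: "1\<^sub>m 1 \<otimes>\<^sub>O A = A"
  by (rule eq_matI) (auto simp: tensor_op_index_div_mod)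

text \<open>Both sides read off the middle digit of a mixed-radix numeral, dropping the leading and
  the last digit in opposite orders.\<close>

lemma mod_mult_div_eq: "(i::nat) mod (b * c) div c = i div c mod b"
  by (cases "c = 0") (auto simp: mod_mult2_eq mult.commute[of b])

lemma tensor_op_assoc: "(A \<otimes>\<^sub>O B) \<otimes>\<^sub>O C = A \<otimes>\<^sub>O (B \<otimes>\<^sub>O C)"
proof (rule eq_matI)
  fix i j
  assume "i < dim_row (A \<otimes>\<^sub>O (B \<otimes>\<^sub>O C))" "j < dim_col (A \<otimes>\<^sub>O (B \<otimes>\<^sub>O C))"
  then have i: "i < dim_row A * (dim_row B * dim_row C)" and j: "j < dim_col A * (dim_col B * dim_col C)"
    by auto
  then have i': "i < dim_row A * dim_row B * dim_row C" and j': "j < dim_col A * dim_col B * dim_col C"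
    by (simp_all add: mult.assoc)
  note b = mod_less_of_less_mult[OF i] mod_less_of_less_mult[OF j]
    less_mult_imp_div_less[OF i'] less_mult_imp_div_less[OF j']
  \<comment> \<open>This settles the leading digits, which index \<open>A\<close>;
    \<open>mod_mult_div_eq\<close> and \<open>mod_mod_cancel\<close> settle those that index
    \<open>B\<close> and \<open>C\<close>.\<close>
  have "i div (dim_row B * dim_row C) = i div dim_row C div dim_row B" 
       "j div (dim_col B * dim_col C) = j div dim_col C div dim_col B"
    by (simp_all add: div_mult2_eq mult.commute [of "dim_row B"] mult.commute [of "dim_col B"])
  then show "((A \<otimes>\<^sub>O B) \<otimes>\<^sub>O C) $$ (i, j) = (A \<otimes>\<^sub>O (B \<otimes>\<^sub>O C)) $$ (i, j)"
    using i j i' j' b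
    by (simp add: tensor_op_index_div_mod mod_mult_div_eq mod_mod_cancel)
qed (auto simp: mult.assoc)

lemma tensor_list_append: "tensor_list (xs @ ys) = tensor_list xs \<otimes>\<^sub>O tensor_list ys"
  by (induction xs) (simp_all add: tensor_list_simps tensor_op_one_left [simplified] tensor_op_assoc)

subsection \<open>Bilinearity of the tensor product of enumerators\<close>

text \<open>Keys outside the support contribute only zeros. Products whose factors have different
  supports can thus be compared over one common index set.\<close>

lemma tensor_prod_superset:
  assumes "finite S" "Poly_Mapping.keys x \<subseteq> S" "finite T" "Poly_Mapping.keys y \<subseteq> T"
  shows "x \<otimes>\<^sub>V y = (\<Sum>k\<in>S. \<Sum>l\<in>T.
      Poly_Mapping.single (k @ l) (Poly_Mapping.lookup x k * Poly_Mapping.lookup y l))"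
proof -
  have "x \<otimes>\<^sub>V y = (\<Sum>k\<in>Poly_Mapping.keys x. \<Sum>l\<in>T.
      Poly_Mapping.single (k @ l) (Poly_Mapping.lookup x k * Poly_Mapping.lookup y l))"
    unfolding tensor_prod_def using assms
    by (intro sum.cong sum.mono_neutral_left) (auto simp: in_keys_iff)
  also have "\<dots> = (\<Sum>k\<in>S. \<Sum>l\<in>T.
      Poly_Mapping.single (k @ l) (Poly_Mapping.lookup x k * Poly_Mapping.lookup y l))"
    using assms by (intro sum.mono_neutral_left) (auto simp: in_keys_iff)
  finally show ?thesis .
qed

lemma tensor_prod_add_left: "(x + x') \<otimes>\<^sub>V y = x \<otimes>\<^sub>V y + x' \<otimes>\<^sub>V y"
proof -
  \<comment> \<open>Cancellation may remove keys from \<open>x + x'\<close>, so all three products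
    are expanded over the union.\<close>
  let ?S = "Poly_Mapping.keys x \<union> Poly_Mapping.keys x'"
  have S: "finite ?S" "Poly_Mapping.keys (x + x') \<subseteq> ?S" "Poly_Mapping.keys x \<subseteq> ?S" "Poly_Mapping.keys x' \<subseteq> ?S"
    by (auto dest: Poly_Mapping.keys_add [THEN subsetD])
  show ?thesis
    using tensor_prod_superset[OF S(1,2) _ order_refl, of y] tensor_prod_superset[OF S(1,3) _ order_refl, of y]
      tensor_prod_superset[OF S(1,4) _ order_refl, of y]
    by (simp add: lookup_add distrib_right single_add sum.distrib)
qed

lemma tensor_prod_add_right: "x \<otimes>\<^sub>V (y + y') = x \<otimes>\<^sub>V y + x \<otimes>\<^sub>V y'"
proof -
  let ?S = "Poly_Mapping.keys y \<union> Poly_Mapping.keys y'"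
  have S: "finite ?S" "Poly_Mapping.keys (y + y') \<subseteq> ?S" "Poly_Mapping.keys y \<subseteq> ?S" "Poly_Mapping.keys y' \<subseteq> ?S"
    by (auto dest: Poly_Mapping.keys_add [THEN subsetD])
  show ?thesis
    using tensor_prod_superset[OF _ order_refl S(1,2), of x] tensor_prod_superset[OF _ order_refl S(1,3), of x]
      tensor_prod_superset[OF _ order_refl S(1,4), of x]
    by (simp add: lookup_add distrib_left single_add sum.distrib)
qed

lemma tensor_prod_zero [simp]: "0 \<otimes>\<^sub>V y = 0" "x \<otimes>\<^sub>V 0 = 0"
  by (simp_all add: tensor_prod_def)

lemma tensor_prod_sum_left: "sum f A \<otimes>\<^sub>V y = (\<Sum>a\<in>A. f a \<otimes>\<^sub>V y)"
  by (induction A rule: infinite_finite_induct) (simp_all add: tensor_prod_add_left)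

lemma tensor_prod_sum_right: "x \<otimes>\<^sub>V sum f A = (\<Sum>a\<in>A. x \<otimes>\<^sub>V f a)"
  by (induction A rule: infinite_finite_induct) (simp_all add: tensor_prod_add_right)

lemma tensor_prod_single:
  "Poly_Mapping.single k a \<otimes>\<^sub>V Poly_Mapping.single l b = Poly_Mapping.single (k @ l) (a * b)"
  \<comment> \<open>The singletons contain the supports even if \<open>a\<close> or \<open>b\<close>
    is zero, when the support is empty.\<close>
  by (subst tensor_prod_superset[where S = "{k}" and T = "{l}"]) simp_all

subsection \<open>Interleaving along a union of leg sets\<close>

lemma rank_Un_shift_left:
  fixes i n :: nat
  assumes "i \<le> n"
  shows "{j \<in> A \<union> (\<lambda>k. n + k) ` B. j < i} = {j \<in> A. j < i}"
  using assms by auto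

text \<open>Legs are numbered from 1, so every shifted leg exceeds \<open>n\<close> and the union is
  disjoint.\<close>

lemma card_Un_shift:
  fixes n :: nat
  assumes "A \<subseteq> {1..n}" "B \<subseteq> {1..n'}"
  shows "card (A \<union> (\<lambda>k. n + k) ` B) = card A + card B"
proof -
  have fin: "finite A" "finite B" using assms by (auto intro: finite_subset)
  have "A \<inter> (\<lambda>k. n + k) ` B = {}"
  proof (rule equals0I)
    fix j assume "j \<in> A \<inter> (\<lambda>k. n + k) ` B"
    then obtain k where "n + k \<in> A" "k \<in> B" by auto
    then have "n + k \<le> n" "1 \<le> k" using assms by auto
    then show False by simp
  qed
  then have "card (A \<union> (\<lambda>k. n + k) ` B) = card A + card ((\<lambda>k. n + k) ` B)"
    using fin by (intro card_Un_disjoint) auto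
  also have "card ((\<lambda>k. n + k) ` B) = card B"
    by (rule card_image) (simp add: inj_on_def)
  finally show ?thesis .
qed

text \<open>All of \<open>A\<close> lies at or below \<open>n\<close>, hence below
  \<open>n + i\<close>, and is counted in full.\<close>

lemma rank_Un_shift_right:
  fixes i n :: nat
  assumes "A \<subseteq> {1..n}" "B \<subseteq> {1..n'}" "0 < i"
  shows "card {j \<in> A \<union> (\<lambda>k. n + k) ` B. j < n + i} = card A + card {j \<in> B. j < i}"
proof -
  have "{j \<in> A \<union> (\<lambda>k. n + k) ` B. j < n + i} = A \<union> (\<lambda>k. n + k) ` {j \<in> B. j < i}"
    using assms by auto
  then show ?thesis using card_Un_shift[of A n "{j \<in> B. j < i}" n'] assms by auto
qed

text \<open>The element \<open>i\<close> does not count itself, so its rank is a valid 0-based index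
  into a list of length \<open>card A\<close>.\<close>

lemma rank_less_card:
  fixes i :: nat
  assumes "finite A" "i \<in> A"
  shows "card {j \<in> A. j < i} < card A"
  using assms by (intro psubset_card_mono) auto

text \<open>The complement is again a union with a shifted set, so the rank lemmas apply to the
  remaining legs as well.\<close>

lemma Diff_Un_shift:
  fixes n n' :: nat
  assumes "J \<subseteq> {1..n}" "K \<subseteq> {1..n'}"
  shows "{1..n + n'} - (J \<union> (\<lambda>k. n + k) ` K) = ({1..n} - J) \<union> (\<lambda>k. n + k) ` ({1..n'} - K)"
proof (rule Set.set_eqI)
  fix x
  show "x \<in> {1..n + n'} - (J \<union> (\<lambda>k. n + k) ` K) \<longleftrightarrow>
    x \<in> ({1..n} - J) \<union> (\<lambda>k. n + k) ` ({1..n'} - K)"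
  proof (cases "x \<le> n")
    case True
    then have "x \<notin> (\<lambda>k. n + k) ` {1..n'}" by auto
    then have "x \<notin> (\<lambda>k. n + k) ` K" "x \<notin> (\<lambda>k. n + k) ` ({1..n'} - K)" using assms by blast+
    then show ?thesis using True by auto
  next
    case False
    then obtain k where x: "x = n + k" by (metis le_add_diff_inverse nat_le_linear)
    then have "x \<notin> J" using False assms by auto
    then show ?thesis using False x by auto
  qed
qed

lemma length_interleave [simp]: "length (interleave n J xs ys) = n"
  by (simp add: interleave_def)

text \<open>The lengths of \<open>xs\<close> and \<open>ys\<close> are exactly the amounts by which
  the ranks of legs beyond \<open>n\<close> grow, within the chosen and within the remaining
  legs.\<close>

lemma interleave_append:
  assumes J: "J \<subseteq> {1..n}" and K: "K \<subseteq> {1..n'}"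
    and len: "length xs = card J" "length ys = n - card J"
  shows "interleave (n + n') (J \<union> (\<lambda>k. n + k) ` K) (xs @ xs') (ys @ ys') =
    interleave n J xs ys @ interleave n' K xs' ys'"
proof -
  let ?J' = "{1..n} - J" and ?K' = "{1..n'} - K"
  let ?f = "\<lambda>n J xs ys i. if i \<in> J then xs ! card {j \<in> J. j < i}
    else ys ! card {j \<in> {1..n} - J. j < (i::nat)}"
  let ?g = "?f (n + n') (J \<union> (\<lambda>k. n + k) ` K) (xs @ xs') (ys @ ys')"
  have fin: "finite J" using J finite_subset by blast
  have len': "length ys = card ?J'" using len J by (simp add: card_Diff_subset fin)
  \<comment> \<open>For a leg up to \<open>n\<close> the rank is unchanged and below the length of
    \<open>xs\<close> or \<open>ys\<close>, so the lookup stays in the first half.\<close>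
  have left: "?g i = ?f n J xs ys i" if i: "i \<in> {1..n}" for i
  proof -
    have m: "i \<in> J \<union> (\<lambda>k. n + k) ` K \<longleftrightarrow> i \<in> J" using i K by auto
    have r: "{j \<in> J \<union> (\<lambda>k. n + k) ` K. j < i} = {j \<in> J. j < i}"
      "{j \<in> {1..n + n'} - (J \<union> (\<lambda>k. n + k) ` K). j < i} = {j \<in> ?J'. j < i}"
      unfolding Diff_Un_shift[OF J K] using i by (intro rank_Un_shift_left; simp)+
    have "card {j \<in> J. j < i} < length xs" if "i \<in> J"
      using rank_less_card[OF fin that] len by simp
    moreover have "card {j \<in> ?J'. j < i} < length ys" if "i \<notin> J"
      using rank_less_card[of ?J' i] that i len' by simp
    ultimately show ?thesis
      unfolding m r by (auto simp: nth_append)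
  qed
  \<comment> \<open>For a leg beyond \<open>n\<close> the rank is offset by the whole first half, so
    the lookup falls into \<open>xs'\<close> or \<open>ys'\<close>.\<close>
  have right: "?g (n + i) = ?f n' K xs' ys' i" if i: "i \<in> {1..n'}" for i
  proof -
    have m: "n + i \<in> J \<union> (\<lambda>k. n + k) ` K \<longleftrightarrow> i \<in> K" using i J by auto
    have r: "card {j \<in> J \<union> (\<lambda>k. n + k) ` K. j < n + i} = length xs + card {j \<in> K. j < i}"
      using rank_Un_shift_right[OF J K] i len by simp
    have r': "card {j \<in> {1..n + n'} - (J \<union> (\<lambda>k. n + k) ` K). j < n + i} = length ys + card {j \<in> ?K'. j < i}"
      unfolding Diff_Un_shift[OF J K] using rank_Un_shift_right[of ?J' n ?K' n' i] i len' by auto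
    show ?thesis by (simp only: m r r' nth_append_length_plus)
  qed
  have "[1..<Suc (n + n')] = [1..<Suc n] @ map (\<lambda>k. n + k) [1..<Suc n']"
    by (induction n') simp_all
  then have "interleave (n + n') (J \<union> (\<lambda>k. n + k) ` K) (xs @ xs') (ys @ ys') =
      map ?g [1..<Suc n] @ map (\<lambda>i. ?g (n + i)) [1..<Suc n']"
    unfolding interleave_def by (simp only: map_append map_map comp_def)
  also have "map ?g [1..<Suc n] = interleave n J xs ys"
    unfolding interleave_def by (rule map_cong[OF refl], rule left) auto
  also have "map (\<lambda>i. ?g (n + i)) [1..<Suc n'] = interleave n' K xs' ys'"
    unfolding interleave_def by (rule map_cong[OF refl], rule right) auto
  finally show ?thesis .
qed

text \<open>The length conditions keep every rank in bounds, where \<open>!\<close> returns an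
  actual list element.\<close>

lemma set_interleave_subset:
  assumes J: "J \<subseteq> {1..n}" and len: "length xs = card J" "length ys = n - card J"
  shows "set (interleave n J xs ys) \<subseteq> set xs \<union> set ys"
proof
  fix x assume "x \<in> set (interleave n J xs ys)"
  then obtain i where "i \<in> set [1..<Suc n]" and
    x: "x = (if i \<in> J then xs ! card {j \<in> J. j < i} else ys ! card {j \<in> {1..n} - J. j < i})"
    unfolding interleave_def set_map by blast
  then have i: "i \<in> {1..n}" by auto
  have fin: "finite J" using J finite_subset by blast
  have "length ys = card ({1..n} - J)" using len J by (simp add: card_Diff_subset fin)
  then show "x \<in> set xs \<union> set ys"
    using x i len rank_less_card[OF fin, of i] rank_less_card[of "{1..n} - J" i]
    by (auto simp: in_set_conv_nth split: if_splits)
qed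

subsection \<open>Enumerators as sums over tuples\<close>

text \<open>Summing over lists of factors instead of operators makes cutting and joining index
  tuples plain list operations.\<close>

definition tuples :: "'a set \<Rightarrow> nat \<Rightarrow> 'a list set" where
  "tuples A m = {xs. length xs = m \<and> set xs \<subseteq> A}"

text \<open>Cutting a list after position \<open>m\<close> is inverse to concatenation.\<close>

lemma sum_tuples_add:
  fixes f :: "'a list \<Rightarrow> 'b::comm_monoid_add"
  shows "(\<Sum>xs\<in>tuples A (m + m'). f xs) = (\<Sum>xs\<in>tuples A m. \<Sum>ys\<in>tuples A m'. f (xs @ ys))"
  unfolding sum.cartesian_product
  by (rule sum.reindex_bij_witness[where i = "\<lambda>(xs, ys). xs @ ys" and j = "\<lambda>xs. (take m xs, drop m xs)"])
    (auto simp: tuples_def dest: in_set_takeD in_set_dropD)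

text \<open>By \<open>tensor_list_inj\<close> an operator determines its tuple of factors, so no
  summand is repeated.\<close>

lemma sum_error_ops:
  assumes "error_basis q \<E>"
  shows "(\<Sum>E\<in>error_ops \<E> m. f E) = (\<Sum>Es\<in>tuples \<E> m. f (tensor_list Es))"
proof -
  have "error_ops \<E> m = tensor_list ` tuples \<E> m"
    by (auto simp: error_ops_def tuples_def)
  moreover have "inj_on tensor_list (tuples \<E> m)"
    using tensor_list_inj[OF assms] by (auto simp: inj_on_def tuples_def)
  ultimately show ?thesis by (simp add: sum.reindex)
qed

lemma factors_tuples:
  assumes "error_basis q \<E>" "Es \<in> tuples \<E> m"
  shows "factors \<E> m (tensor_list Es) = Es"
  using factors_tensor_list[OF assms(1), of Es] assms(2) by (auto simp: tuples_def)

text \<open>The common shape of both enumerators, which differ only in the trace coefficient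
  \<open>\<phi>\<close>; the product formula is thus proved once for both.\<close>

definition tuple_enum ::
  "nat \<Rightarrow> complex mat set \<Rightarrow> nat \<Rightarrow> nat \<Rightarrow>
    (complex mat list \<Rightarrow> complex mat list \<Rightarrow> complex mat list \<Rightarrow> complex) \<Rightarrow> tensor" where
  "tuple_enum q \<E> m k \<phi> =
     (\<Sum>Es\<in>tuples \<E> m. \<Sum>Es'\<in>tuples \<E> m. \<Sum>Fs\<in>tuples \<E> k.
        Poly_Mapping.single (zip Es Es')
          (Polynomial.monom (\<phi> Es Es' Fs) (length (filter (\<lambda>F. F \<noteq> 1\<^sub>m q) Fs))))"

text \<open>In this form the weight is visibly additive under concatenation.\<close>

lemma wt_tensor_list:
  assumes "error_basis q \<E>" "Fs \<in> tuples \<E> k"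
  shows "wt q \<E> k (tensor_list Fs) = length (filter (\<lambda>F. F \<noteq> 1\<^sub>m q) Fs)"
  using assms(2) by (auto simp: wt_def factors_tuples [OF assms] length_filter_conv_card tuples_def)

lemma tensor_at_tensor_list:
  assumes "error_basis q \<E>" "Es \<in> tuples \<E> (card J)" "Fs \<in> tuples \<E> (n - card J)"
  shows "tensor_at \<E> n J (tensor_list Es) (tensor_list Fs) = tensor_list (interleave n J Es Fs)"
  using assms(2,3) by (simp add: tensor_at_def factors_tuples [OF assms(1)])

lemma enum_A_eq_tuple_enum:
  assumes "error_basis q \<E>"
  shows "enum_A q \<E> n J M1 M2 = tuple_enum q \<E> (card J) (n - card J)
    (\<lambda>Es Es' Fs. trace (mat_adjoint (tensor_list (interleave n J Es Fs)) * M1) *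
      trace (tensor_list (interleave n J Es' Fs) * M2))"
  unfolding enum_A_def tuple_enum_def sum_error_ops[OF assms] term_e_def
  by (intro sum.cong refl)
    (simp add: assms wt_tensor_list tensor_at_tensor_list [OF assms] factors_tuples [OF assms])

lemma enum_B_eq_tuple_enum:
  assumes "error_basis q \<E>"
  shows "enum_B q \<E> n J M1 M2 = tuple_enum q \<E> (card J) (n - card J)
    (\<lambda>Es Es' Fs. trace (mat_adjoint (tensor_list (interleave n J Es Fs)) * M1 *
      tensor_list (interleave n J Es' Fs) * M2))"
  unfolding enum_B_def tuple_enum_def sum_error_ops[OF assms] term_e_def
  by (intro sum.cong refl)
    (simp add: assms wt_tensor_list tensor_at_tensor_list [OF assms] factors_tuples [OF assms])

section \<open>Product formula for sums over tuples\<close>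

lemma sum_swap3:
  "(\<Sum>a\<in>A. \<Sum>b\<in>B. \<Sum>c\<in>C. f a b c) = (\<Sum>c\<in>C. \<Sum>a\<in>A. \<Sum>b\<in>B. f a b c)"
  by (subst sum.swap[of _ B C for B], subst sum.swap[of _ C A for C A]) (rule refl)

text \<open>Under concatenation the basis vectors concatenate and the exponents of z add, so
  multiplicativity of the coefficient is all that is required.\<close>

lemma tuple_enum_add:
  assumes mult: "\<And>Es Gs Es' Gs' Fs Hs.
      \<lbrakk>Es \<in> tuples \<E> m; Gs \<in> tuples \<E> m'; Es' \<in> tuples \<E> m; Gs' \<in> tuples \<E> m';
        Fs \<in> tuples \<E> k; Hs \<in> tuples \<E> k'\<rbrakk>
      \<Longrightarrow> \<chi> (Es @ Gs) (Es' @ Gs') (Fs @ Hs) = \<phi> Es Es' Fs * \<psi> Gs Gs' Hs"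
  shows "tuple_enum q \<E> (m + m') (k + k') \<chi> = tuple_enum q \<E> m k \<phi> \<otimes>\<^sub>V tuple_enum q \<E> m' k' \<psi>"
proof -
  \<comment> \<open>The coefficient function is a parameter of \<open>t\<close>, so that one name
    covers the summands for \<open>\<phi>\<close>, \<open>\<psi>\<close> and
    \<open>\<chi>\<close>.\<close>
  define t where "t \<phi> Es Es' Fs = Poly_Mapping.single (zip Es Es')
    (Polynomial.monom (\<phi> Es Es' Fs :: complex) (length (filter (\<lambda>F. F \<noteq> 1\<^sub>m q) Fs)))"
    for \<phi> and Es Es' Fs :: "complex mat list"
  have t: "t \<chi> (Es @ Gs) (Es' @ Gs') (Fs @ Hs) = t \<phi> Es Es' Fs \<otimes>\<^sub>V t \<psi> Gs Gs' Hs"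
    if "Es \<in> tuples \<E> m" "Gs \<in> tuples \<E> m'" "Es' \<in> tuples \<E> m" "Gs' \<in> tuples \<E> m'"
      "Fs \<in> tuples \<E> k" "Hs \<in> tuples \<E> k'" for Es Gs Es' Gs' Fs Hs
  proof -
    \<comment> \<open>\<open>Es\<close> and \<open>Es'\<close> have the same length, so
      \<open>zip\<close> breaks at the same place in both lists.\<close>
    have "zip (Es @ Gs) (Es' @ Gs') = zip Es Es' @ zip Gs Gs'"
      using that by (simp add: tuples_def)
    then show ?thesis
      using mult[OF that] by (simp add: t_def tensor_prod_single mult_monom)
  qed
  have "tuple_enum q \<E> (m + m') (k + k') \<chi> =
    (\<Sum>Es\<in>tuples \<E> m. \<Sum>Gs\<in>tuples \<E> m'. \<Sum>Es'\<in>tuples \<E> m. \<Sum>Gs'\<in>tuples \<E> m'.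
      \<Sum>Fs\<in>tuples \<E> k. \<Sum>Hs\<in>tuples \<E> k'. t \<chi> (Es @ Gs) (Es' @ Gs') (Fs @ Hs))"
    unfolding tuple_enum_def t_def[symmetric] sum_tuples_add ..
  also have "\<dots> =
    (\<Sum>Es\<in>tuples \<E> m. \<Sum>Gs\<in>tuples \<E> m'. \<Sum>Es'\<in>tuples \<E> m. \<Sum>Gs'\<in>tuples \<E> m'.
      \<Sum>Fs\<in>tuples \<E> k. \<Sum>Hs\<in>tuples \<E> k'. t \<phi> Es Es' Fs \<otimes>\<^sub>V t \<psi> Gs Gs' Hs)"
    by (intro sum.cong refl t)
  also have "\<dots> =
    (\<Sum>Es\<in>tuples \<E> m. \<Sum>Es'\<in>tuples \<E> m. \<Sum>Fs\<in>tuples \<E> k. 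
      \<Sum>Gs\<in>tuples \<E> m'. \<Sum>Gs'\<in>tuples \<E> m'. \<Sum>Hs\<in>tuples \<E> k'. t \<phi> Es Es' Fs \<otimes>\<^sub>V t \<psi> Gs Gs' Hs)"
  proof (rule sum.cong[OF refl])
    fix Es
    show "(\<Sum>Gs\<in>tuples \<E> m'. \<Sum>Es'\<in>tuples \<E> m. \<Sum>Gs'\<in>tuples \<E> m'.
        \<Sum>Fs\<in>tuples \<E> k. \<Sum>Hs\<in>tuples \<E> k'. t \<phi> Es Es' Fs \<otimes>\<^sub>V t \<psi> Gs Gs' Hs) =
      (\<Sum>Es'\<in>tuples \<E> m. \<Sum>Fs\<in>tuples \<E> k.
        \<Sum>Gs\<in>tuples \<E> m'. \<Sum>Gs'\<in>tuples \<E> m'. \<Sum>Hs\<in>tuples \<E> k'. t \<phi> Es Es' Fs \<otimes>\<^sub>V t \<psi> Gs Gs' Hs)"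
      \<comment> \<open>First \<open>Es'\<close> moves in front of \<open>Gs\<close>, then
        \<open>sum_swap3\<close> moves \<open>Fs\<close> in front of \<open>Gs\<close> and
        \<open>Gs'\<close>.\<close>
      by (subst sum.swap) (intro sum.cong refl sum_swap3)
  qed
  also have "\<dots> = tuple_enum q \<E> m k \<phi> \<otimes>\<^sub>V tuple_enum q \<E> m' k' \<psi>"
    \<comment> \<open>Expanding the left factor before the right one produces exactly the order of
      summation reached above.\<close>
    unfolding tuple_enum_def t_def[symmetric] tensor_prod_sum_left
    by (simp only: tensor_prod_sum_right)
  finally show ?thesis .
qed

section \<open>Factorisation of the trace coefficients\<close>

lemma trace_adjoint_mult_tensor_op:
  assumes "X \<in> carrier_mat a a" "M \<in> carrier_mat a a" "Y \<in> carrier_mat b b" "N \<in> carrier_mat b b"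
  shows "trace (mat_adjoint (X \<otimes>\<^sub>O Y) * (M \<otimes>\<^sub>O N)) =
    trace (mat_adjoint X * M) * trace (mat_adjoint Y * N)"
  using assms by (simp add: mat_adjoint_tensor_op tensor_op_mult trace_tensor_op)

lemma trace_mult_tensor_op:
  assumes "X \<in> carrier_mat a a" "M \<in> carrier_mat a a" "Y \<in> carrier_mat b b" "N \<in> carrier_mat b b"
  shows "trace ((X \<otimes>\<^sub>O Y) * (M \<otimes>\<^sub>O N)) = trace (X * M) * trace (Y * N)"
  using assms by (simp add: tensor_op_mult trace_tensor_op)

lemma trace_adjoint_mult4_tensor_op:
  assumes "X \<in> carrier_mat a a" "M \<in> carrier_mat a a" "X' \<in> carrier_mat a a" "M' \<in> carrier_mat a a"
    "Y \<in> carrier_mat b b" "N \<in> carrier_mat b b" "Y' \<in> carrier_mat b b" "N' \<in> carrier_mat b b"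
  shows "trace (mat_adjoint (X \<otimes>\<^sub>O Y) * (M \<otimes>\<^sub>O N) * (X' \<otimes>\<^sub>O Y') * (M' \<otimes>\<^sub>O N')) =
    trace (mat_adjoint X * M * X' * M') * trace (mat_adjoint Y * N * Y' * N')"
  using assms by (simp add: mat_adjoint_tensor_op tensor_op_mult trace_tensor_op)

text \<open>Supplies the dimension conditions of the trace identities: an interleaving of basis
  tuples is again a tuple of \<open>q\<close> by \<open>q\<close> matrices.\<close>

lemma tensor_list_interleave_carrier:
  assumes "error_basis q \<E>" "J \<subseteq> {1..n}" "Es \<in> tuples \<E> (card J)" "Fs \<in> tuples \<E> (n - card J)"
  shows "tensor_list (interleave n J Es Fs) \<in> carrier_mat (q ^ n) (q ^ n)"
proof -
  have "set (interleave n J Es Fs) \<subseteq> \<E>"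
    using set_interleave_subset[of J n Es Fs] assms by (auto simp: tuples_def)
  then have "X \<in> carrier_mat q q" if "X \<in> set (interleave n J Es Fs)" for X
    using that assms(1) by (auto simp: error_basis_def unitary_op_def)
  then show ?thesis using tensor_list_carrier[of "interleave n J Es Fs" q] by simp
qed

theorem propositionV3:
  fixes q n n' :: nat and \<E> :: "complex mat set"
    and M1 M2 N1 N2 :: "complex mat" and J K :: "nat set"
  assumes "error_basis q \<E>"
    and "hermitian_op (q ^ n) M1" and "hermitian_op (q ^ n) M2"
    and "hermitian_op (q ^ n') N1" and "hermitian_op (q ^ n') N2"
    and "J \<subseteq> {1..n}" and "K \<subseteq> {1..n'}"
  shows "(enum_A q \<E> (n + n') (J \<union> (\<lambda>k. n + k) ` K) (M1 \<otimes>\<^sub>O N1) (M2 \<otimes>\<^sub>O N2)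
           = enum_A q \<E> n J M1 M2 \<otimes>\<^sub>V enum_A q \<E> n' K N1 N2)
       \<and> (enum_B q \<E> (n + n') (J \<union> (\<lambda>k. n + k) ` K) (M1 \<otimes>\<^sub>O N1) (M2 \<otimes>\<^sub>O N2)
           = enum_B q \<E> n J M1 M2 \<otimes>\<^sub>V enum_B q \<E> n' K N1 N2)"
proof -
  note eb = assms(1) and J = assms(6) and K = assms(7)
  have M: "M1 \<in> carrier_mat (q ^ n) (q ^ n)" "M2 \<in> carrier_mat (q ^ n) (q ^ n)"
    and N: "N1 \<in> carrier_mat (q ^ n') (q ^ n')" "N2 \<in> carrier_mat (q ^ n') (q ^ n')"
    using assms by (auto simp: hermitian_op_def)
  let ?JK = "J \<union> (\<lambda>k. n + k) ` K"
  have c: "card ?JK = card J + card K" by (rule card_Un_shift[OF J K])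
  \<comment> \<open>These bounds keep the natural-number subtractions in \<open>d\<close> from
    truncating.\<close>
  have "card J \<le> n" "card K \<le> n'"
    using card_mono[OF _ J] card_mono[OF _ K] by auto
  then have d: "n + n' - card ?JK = (n - card J) + (n' - card K)" using c by simp
  have split: "tensor_list (interleave (n + n') ?JK (Es @ Gs) (Fs @ Hs)) =
      tensor_list (interleave n J Es Fs) \<otimes>\<^sub>O tensor_list (interleave n' K Gs Hs)"
    if "Es \<in> tuples \<E> (card J)" "Fs \<in> tuples \<E> (n - card J)" for Es Gs Fs Hs
    using that by (subst interleave_append[OF J K]) (simp_all add: tuples_def tensor_list_append)
  note carJ = tensor_list_interleave_carrier[OF eb J] and carK = tensor_list_interleave_carrier[OF eb K]
  have "enum_A q \<E> (n + n') ?JK (M1 \<otimes>\<^sub>O N1) (M2 \<otimes>\<^sub>O N2) = enum_A q \<E> n J M1 M2 \<otimes>\<^sub>V enum_A q \<E> n' K N1 N2"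
    \<comment> \<open>The cardinality must still be intact for \<open>d\<close> to match, so
      \<open>c\<close> is unfolded afterwards.\<close>
    unfolding enum_A_eq_tuple_enum[OF eb] d unfolding c
    by (rule tuple_enum_add)
      \<comment> \<open>Each of the two traces splits into a \<open>J\<close> and a \<open>K\<close>
        part; \<open>mult_ac\<close> regroups the four factors by leg set.\<close>
      (simp only: split trace_adjoint_mult_tensor_op[OF carJ M(1) carK N(1)]
        trace_mult_tensor_op[OF carJ M(2) carK N(2)] mult_ac)
  moreover have "enum_B q \<E> (n + n') ?JK (M1 \<otimes>\<^sub>O N1) (M2 \<otimes>\<^sub>O N2) = enum_B q \<E> n J M1 M2 \<otimes>\<^sub>V enum_B q \<E> n' K N1 N2"
    unfolding enum_B_eq_tuple_enum[OF eb] d unfolding c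
    by (rule tuple_enum_add)
      (simp only: split trace_adjoint_mult4_tensor_op[OF carJ M(1) carJ M(2) carK N(1) carK N(2)])
  ultimately show ?thesis by blast
qed

end
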